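(* Let $p:\mathbb{C}\to[0,\infty[$ be a growth condition and let $g\in A^0_p$ be non-constant. (i) If the condition $M(g,r)=o(p(r))$ as $r\to\infty$ is not satisfied (which happens in case $p(r)=O(r)$ as $r\to\infty$), then $\sigma(V_g,A^0_p)=\mathbb{C}$. (ii) If $M(g,r)=o(p(r))$ as $r\to\infty$, then $\sigma(V_g,A^0_p)=\{0\}$. In this case $g$ is a polynomial and $r=o(p(r))$ as $r\to\infty$. Moreover, in both cases $\sigma(V_g,A^0_p)=\{0\}\cup\overline{\{\lambda\in\mathbb{C}\setminus\{0\} : e^{g/\lambda}\notin A^0_p\}}$.
   Context: $H(\mathbb{C})$ is the space of entire functions. A growth condition is a function $p:\mathbb{C}\to[0,\infty[$ that is continuous, subharmonic, radial, increases with $|z|$, and satisfies $\log(1+|z|^2)=o(p(|z|))$ as $|z|\to\infty$ and $p(2|z|)=O(p(|z|))$ as $|z|\to\infty$. The Hörmander algebra $A^0_p$ is $A^0_p=\{f\in H(\mathbb{C}) : \text{for all } \varepsilon>0,\ \sup_{z\in\mathbb{C}}|f(z)|\exp(-\varepsilon p(z))<\infty\}$, endowed with the projective limit topology, i.e. the Fréchet topology given by the norms $f\mapsto\sup_{z}|f(z)|\exp(-\varepsilon p(z))$, $\varepsilon>0$. For entire $g$, $M(g,r)=\max\{|g(z)| : |z|=r\}$. The Volterra operator with symbol $g$ is $V_g f(z)=\int_0^z f(\zeta)g'(\zeta)\,d\zeta$, $z\in\mathbb{C}$; for $g\in A^0_p$ it is a continuous operator from $A^0_p$ to itself. For a continuous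 operator $T:X\to X$ on a Hausdorff locally convex space $X$, the resolvent set $\rho(T,X)$ is the set of $\lambda\in\mathbb{C}$ such that $T-\lambda I:X\to X$ is bijective with continuous inverse, and the spectrum is $\sigma(T,X)=\mathbb{C}\setminus\rho(T,X)$. The bar denotes closure in $\mathbb{C}$. *)

theory Defs
  imports "HOL-Complex_Analysis.Complex_Analysis" "HOL-Library.Landau_Symbols"
begin

text \<open>
  Subharmonicity of a finite-valued function on the plane: upper semicontinuity and the
  sub-mean-value inequality on all circles. For a finite-valued subharmonic function the
  circle means are finite, so demanding integrability loses nothing; since the function is bounded
  above on circles, the integral below agrees with the Lebesgue integral.
\<close>

definition subharmonic :: "(complex \<Rightarrow> real) \<Rightarrow> bool" where
  "subharmonic u \<longleftrightarrow>
     (\<forall>z c. u z < c \<longrightarrow> (\<forall>\<^sub>F w in at z. u w < c)) \<and>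
     (\<forall>z r. r > 0 \<longrightarrow>
        (\<lambda>t. u (z + of_real r * cis t)) integrable_on {0..2*pi} \<and>
        u z \<le> integral {0..2*pi} (\<lambda>t. u (z + of_real r * cis t)) / (2 * pi))"

definition growth_condition :: "(complex \<Rightarrow> real) \<Rightarrow> bool" where
  "growth_condition p \<longleftrightarrow>
     (\<forall>z. 0 \<le> p z) \<and>
     continuous_on UNIV p \<and>
     subharmonic p \<and>
     (\<forall>z w. norm z = norm w \<longrightarrow> p z = p w) \<and>
     (\<forall>z w. norm z \<le> norm w \<longrightarrow> p z \<le> p w) \<and>
     (\<lambda>z. ln (1 + (norm z)\<^sup>2)) \<in> o[at_infinity](p) \<and>
     (\<lambda>z. p (2 * z)) \<in> O[at_infinity](p)"

definition A0 :: "(complex \<Rightarrow> real) \<Rightarrow> (complex \<Rightarrow> complex) set" where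
  "A0 p = {f. f holomorphic_on UNIV \<and>
              (\<forall>\<epsilon>>0. bdd_above (range (\<lambda>z. norm (f z) * exp (- \<epsilon> * p z))))}"

definition A0_norm :: "(complex \<Rightarrow> real) \<Rightarrow> real \<Rightarrow> (complex \<Rightarrow> complex) \<Rightarrow> real" where
  "A0_norm p \<epsilon> f = (SUP z. norm (f z) * exp (- \<epsilon> * p z))"

text \<open>The projective limit topology: the open balls of all the norms form a subbase.\<close>

definition A0_topology :: "(complex \<Rightarrow> real) \<Rightarrow> (complex \<Rightarrow> complex) topology" where
  "A0_topology p = topology_generated_by
     {{h \<in> A0 p. A0_norm p \<epsilon> (\<lambda>z. h z - f z) < \<delta>} | f \<epsilon> \<delta>. f \<in> A0 p \<and> \<epsilon> > 0 \<and> \<delta> > 0}"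

definition max_modulus :: "(complex \<Rightarrow> complex) \<Rightarrow> real \<Rightarrow> real" where
  "max_modulus g r = (SUP z\<in>sphere 0 r. norm (g z))"

definition volterra :: "(complex \<Rightarrow> complex) \<Rightarrow> (complex \<Rightarrow> complex) \<Rightarrow> complex \<Rightarrow> complex" where
  "volterra g f z = contour_integral (linepath 0 z) (\<lambda>\<zeta>. f \<zeta> * deriv g \<zeta>)"

text \<open>
  Resolvent set and spectrum of an operator on a space of complex functions, the space and its
  topology both being given by an abstract topology \<open>X\<close>.
\<close>

definition resolvent_set ::
    "(complex \<Rightarrow> complex) topology \<Rightarrow> ((complex \<Rightarrow> complex) \<Rightarrow> complex \<Rightarrow> complex) \<Rightarrow> complex set" where
  "resolvent_set X T =
     {l. bij_betw (\<lambda>f z. T f z - l * f z) (topspace X) (topspace X) \<and>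
         continuous_map X X (inv_into (topspace X) (\<lambda>f z. T f z - l * f z))}"

definition spectrum ::
    "(complex \<Rightarrow> complex) topology \<Rightarrow> ((complex \<Rightarrow> complex) \<Rightarrow> complex \<Rightarrow> complex) \<Rightarrow> complex set" where
  "spectrum X T = UNIV - resolvent_set X T"

lemma topspace_A0_topology: "topspace (A0_topology p) = A0 p"
proof
  show "topspace (A0_topology p) \<subseteq> A0 p"
    unfolding A0_topology_def topology_generated_by_topspace by (rule Union_least) auto
  show "A0 p \<subseteq> topspace (A0_topology p)"
  proof
    fix f assume f: "f \<in> A0 p"
    have "f \<in> {h \<in> A0 p. A0_norm p 1 (\<lambda>z. h z - f z) < 1}"
      using f by (simp add: A0_norm_def)
    moreover have "{h \<in> A0 p. A0_norm p 1 (\<lambda>z. h z - f z) < 1} \<in>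
        {{h \<in> A0 p. A0_norm p \<epsilon> (\<lambda>z. h z - f z) < \<delta>} | f \<epsilon> \<delta>. f \<in> A0 p \<and> \<epsilon> > 0 \<and> \<delta> > 0}"
      by (rule CollectI, rule exI[of _ f], rule exI[of _ 1], rule exI[of _ 1]) (simp add: f)
    ultimately show "f \<in> topspace (A0_topology p)"
      unfolding A0_topology_def topology_generated_by_topspace by (rule UnionI[rotated])
  qed
qed

end

theory Submission
  imports Defs
begin

text \<open>
  For \<open>l \<noteq> 0\<close> the equation \<open>V\<^sub>g f - l f = h\<close> is a first order linear differential equation with a
  prescribed value at the origin. It has exactly one entire solution
  \<open>f = - (1 / l) exp (g / l) (h(0) exp (- g(0) / l) + \<integral> h' exp (- g / l))\<close>, the integral being taken
  from \<open>0\<close> to \<open>z\<close>, and everything depends on whether this formula stays inside the algebra. With \<open>h = 1\<close> it gives a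
  multiple of \<open>exp (g / l)\<close>, so a nonzero \<open>l\<close> in the resolvent set forces \<open>exp (g / l)\<close> into the algebra
  (\<open>in_resolvent_set_imp_exp_mem_A0\<close>). Conversely, if both \<open>exp (g / l)\<close> and \<open>exp (- g / l)\<close> belong to the algebra,
  then the formula defines a continuous inverse, because the algebra is stable, with estimates, under
  differentiation, multiplication and integration (\<open>exp_mem_A0_imp_in_resolvent_set\<close>).

  The dichotomy comes from the fact that membership of \<open>exp (g / l)\<close> is independent of \<open>l \<noteq> 0\<close>: it is
  equivalent to \<open>M(g, r) = o(p(r))\<close>. That this suffices is immediate from \<open>|exp (g / l)| \<le> exp (|g| / |l|)\<close>. For
  necessity, membership bounds \<open>Re (g / l)\<close> from above by \<open>\<epsilon> p + C\<close>, the Borel--Caratheodory inequality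
  converts this into a bound on \<open>|g|\<close> in terms of \<open>p(2 z)\<close>, and \<open>p(2 z) = O(p(z))\<close>
  (\<open>exp_mem_A0_imp_smallo\<close>). So either no \<open>exp (g / l)\<close> lies in the algebra and every \<open>l \<noteq> 0\<close> is in the
  spectrum, or all of them do and none is. The point \<open>0\<close> is always in the spectrum, since \<open>V\<^sub>g f\<close>
  vanishes at the origin.

  The remaining assertions compare growth rates. The doubling condition makes \<open>p\<close> at most polynomial,
  so \<open>M(g, r) = o(p(r))\<close> makes \<open>g\<close> a polynomial by Liouville's theorem; and \<open>r = O(M(g, r))\<close> for every
  non-constant entire \<open>g\<close>, so that \<open>r = o(p(r))\<close>, which is incompatible with \<open>p(r) = O(r)\<close>.
\<close>

section \<open>Growth conditions\<close>

lemma growth_condition_nonneg: "growth_condition p \<Longrightarrow> 0 \<le> p z"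
  unfolding growth_condition_def by blast

lemma growth_condition_mono: "growth_condition p \<Longrightarrow> norm z \<le> norm w \<Longrightarrow> p z \<le> p w"
  unfolding growth_condition_def by blast

lemma growth_condition_radial: "growth_condition p \<Longrightarrow> p (of_real (norm z)) = p z"
  by (simp add: order_antisym growth_condition_mono)

lemma growth_condition_doubling:
  assumes "growth_condition p"
  obtains D where "D \<ge> 1" "\<And>z. p (2 * z) \<le> D * p z + D"
proof -
  have nn: "0 \<le> p z" for z
    using assms by (rule growth_condition_nonneg)
  have "(\<lambda>z. p (2 * z)) \<in> O[at_infinity](p)"
    using assms unfolding growth_condition_def by blast
  then obtain c where c: "c > 0" "\<forall>\<^sub>F z in at_infinity. norm (p (2 * z)) \<le> c * norm (p z)"
    by (rule landau_o.bigE)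
  then obtain b where b: "\<And>z. norm z \<ge> b \<Longrightarrow> p (2 * z) \<le> c * p z"
    using nn by (auto simp: eventually_at_infinity)
  define D where "D = c + p (2 * of_real \<bar>b\<bar>) + 1"
  have D: "c \<le> D" "p (2 * of_real \<bar>b\<bar>) \<le> D" "1 \<le> D"
    using c(1) nn[of "2 * of_real \<bar>b\<bar>"] by (auto simp: D_def)
  have "p (2 * z) \<le> D * p z + D" for z
  proof (cases "norm z \<ge> b")
    case True
    have "p (2 * z) \<le> c * p z" using b True by blast
    also have "\<dots> \<le> D * p z" using D nn by (intro mult_right_mono) auto
    finally show ?thesis using D by simp
  next
    case False
    have "p (2 * z) \<le> p (2 * of_real \<bar>b\<bar>)"
      using False by (intro growth_condition_mono[OF assms]) (simp add: norm_mult)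
    also have "\<dots> \<le> D * p z + D" using D nn[of z] by (simp add: add_increasing)
    finally show ?thesis .
  qed
  with D(3) show ?thesis by (rule that)
qed

text \<open>When \<open>|w| \<ge> 1\<close>, moving \<open>w\<close> by at most one stays in the disc of radius \<open>|2 w|\<close>; otherwise it
  stays in the disc of radius two, where \<open>p\<close> is bounded. The lemma lets Cauchy estimates on unit
  circles be read as growth estimates.\<close>

lemma growth_condition_unit_shift:
  assumes "growth_condition p"
  obtains D where "D \<ge> 1" "\<And>u w. norm (u - w) \<le> 1 \<Longrightarrow> p u \<le> D * p w + D"
proof -
  obtain D where D: "D \<ge> 1" "\<And>z. p (2 * z) \<le> D * p z + D"
    using growth_condition_doubling[OF assms] by blast
  have nn: "0 \<le> p z" for z
    using assms by (rule growth_condition_nonneg)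
  have "p u \<le> (D + p 2) * p w + (D + p 2)" if uw: "norm (u - w) \<le> 1" for u w
  proof -
    have u: "norm u \<le> norm w + 1"
      using norm_triangle_sub[of u w] uw by linarith
    have "p u \<le> D * p w + D + p 2"
    proof (cases "norm w \<ge> 1")
      case True
      have "p u \<le> p (2 * w)"
        using u True by (intro growth_condition_mono[OF assms]) (simp add: norm_mult)
      then show ?thesis using D(2)[of w] nn[of 2] by linarith
    next
      case False
      have "p u \<le> p 2"
        using u False by (intro growth_condition_mono[OF assms]) simp
      moreover have "0 \<le> D * p w" using D nn by simp
      ultimately show ?thesis using D by linarith
    qed
    also have "\<dots> \<le> (D + p 2) * p w + (D + p 2)"
      using nn by (simp add: algebra_simps)
    finally show ?thesis .
  qed
  moreover have "D + p 2 \<ge> 1" using D nn[of 2] by linarith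
  ultimately show ?thesis using that by blast
qed

lemma growth_condition_absorbs_norm:
  assumes "growth_condition p" "\<epsilon> > 0"
  obtains K where "K > 0" "\<And>z. 1 + norm z \<le> K * exp (\<epsilon> * p z)"
proof -
  have nn: "0 \<le> p z" for z
    using assms(1) by (rule growth_condition_nonneg)
  have "(\<lambda>z::complex. ln (1 + (norm z)\<^sup>2)) \<in> o[at_infinity](p)"
    using assms(1) unfolding growth_condition_def by blast
  from landau_o.smallD[OF this assms(2)]
  obtain b where b: "\<And>z::complex. norm z \<ge> b \<Longrightarrow> \<bar>ln (1 + (norm z)\<^sup>2)\<bar> \<le> \<epsilon> * p z"
    using nn by (auto simp: eventually_at_infinity)
  have "1 + norm z \<le> (2 + \<bar>b\<bar>) * exp (\<epsilon> * p z)" for z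
  proof (cases "norm z \<ge> b")
    case True
    have "2 * norm z \<le> 1 + (norm z)\<^sup>2"
      using zero_le_power2[of "norm z - 1"] by (simp add: power2_diff)
    then have "1 + norm z \<le> 2 * (1 + (norm z)\<^sup>2)"
      using zero_le_power2[of "norm z"] unfolding distrib_left by linarith
    also have "1 + (norm z)\<^sup>2 = exp (ln (1 + (norm z)\<^sup>2))"
      by (simp add: add_pos_nonneg)
    also have "\<dots> \<le> exp (\<epsilon> * p z)"
      using b[OF True] by simp
    also have "2 * exp (\<epsilon> * p z) \<le> (2 + \<bar>b\<bar>) * exp (\<epsilon> * p z)"
      by (intro mult_right_mono) auto
    finally show ?thesis by simp
  next
    case False
    have "1 + norm z \<le> (2 + \<bar>b\<bar>) * 1" using False by simp
    also have "\<dots> \<le> (2 + \<bar>b\<bar>) * exp (\<epsilon> * p z)"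
      using assms(2) nn[of z] by (intro mult_left_mono) auto
    finally show ?thesis .
  qed
  then show ?thesis by (intro that[of "2 + \<bar>b\<bar>"]) auto
qed

lemma growth_condition_tends_to_infinity:
  assumes "growth_condition p"
  shows "filterlim (\<lambda>r. p (of_real r)) at_top at_top"
proof -
  obtain K where K: "K > 0" "\<And>z. 1 + norm z \<le> K * exp (1 * p z)"
    using growth_condition_absorbs_norm[OF assms zero_less_one] by metis
  show ?thesis
    unfolding filterlim_at_top
  proof
    fix Z :: real
    show "\<forall>\<^sub>F r in at_top. Z \<le> p (of_real r)"
      using eventually_ge_at_top[of "K * exp Z"]
    proof eventually_elim
      case (elim r)
      then have "K * exp Z \<le> 1 + norm (of_real r :: complex)"
        by simp
      also have "\<dots> \<le> K * exp (1 * p (of_real r))" by (rule K)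
      finally show ?case using K(1) by simp
    qed
  qed
qed

text \<open>Doubling the argument multiplies \<open>p + 1\<close> by a bounded factor, say at most \<open>2 ^ n\<close>, and
  it takes about \<open>log\<^sub>2 |z|\<close> doublings to reach \<open>z\<close> from the unit disc.\<close>

lemma growth_condition_polynomial_bound:
  assumes "growth_condition p"
  obtains n where "\<And>z. p z + 1 \<le> (p 1 + 1) * (max 1 (2 * norm z)) ^ n"
proof -
  obtain D where D: "D \<ge> 1" "\<And>z. p (2 * z) \<le> D * p z + D"
    using growth_condition_doubling[OF assms] by blast
  have nn: "0 \<le> p z" for z
    using assms by (rule growth_condition_nonneg)
  obtain n where n: "D + 1 < 2 ^ n"
    using real_arch_pow[of 2 "D + 1"] by auto
  have step: "p z + 1 \<le> 2 ^ n * (p (z / 2) + 1)" for z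
  proof -
    have "p z + 1 \<le> (D + 1) * (p (z / 2) + 1)"
      using D(2)[of "z / 2"] nn[of "z / 2"] by (simp add: algebra_simps)
    also have "\<dots> \<le> 2 ^ n * (p (z / 2) + 1)"
      using n nn[of "z / 2"] by (intro mult_right_mono) auto
    finally show ?thesis .
  qed
  have main: "p z + 1 \<le> (p 1 + 1) * (max 1 (2 * norm z)) ^ n" if "norm z \<le> 2 ^ m" for m z
    using that
  proof (induction m arbitrary: z)
    case 0
    have "p z + 1 \<le> (p 1 + 1) * 1"
      using 0 by (simp add: growth_condition_mono[OF assms])
    also have "\<dots> \<le> (p 1 + 1) * (max 1 (2 * norm z)) ^ n"
      using nn[of 1] by (intro mult_left_mono one_le_power) auto
    finally show ?case .
  next
    case (Suc m)
    show ?case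
    proof (cases "norm z \<le> 1")
      case True
      have "p z + 1 \<le> (p 1 + 1) * 1"
        using True by (simp add: growth_condition_mono[OF assms])
      also have "\<dots> \<le> (p 1 + 1) * (max 1 (2 * norm z)) ^ n"
        using nn[of 1] by (intro mult_left_mono one_le_power) auto
      finally show ?thesis .
    next
      case False
      have "norm (z / 2) \<le> 2 ^ m" using Suc.prems by (simp add: norm_divide)
      then have "p (z / 2) + 1 \<le> (p 1 + 1) * (max 1 (norm z)) ^ n"
        using Suc.IH[of "z / 2"] by (simp add: norm_divide)
      then have "2 ^ n * (p (z / 2) + 1) \<le> 2 ^ n * ((p 1 + 1) * (max 1 (norm z)) ^ n)"
        by (intro mult_left_mono) auto
      also have "\<dots> = (p 1 + 1) * (max 1 (2 * norm z)) ^ n"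
        using False by (simp add: max_def power_mult_distrib)
      finally show ?thesis using step[of z] by linarith
    qed
  qed
  show ?thesis
  proof (rule that)
    fix z :: complex
    obtain m where "norm z < 2 ^ m" using real_arch_pow[of 2 "norm z"] by auto
    then show "p z + 1 \<le> (p 1 + 1) * (max 1 (2 * norm z)) ^ n"
      by (intro main[of z m]) auto
  qed
qed

section \<open>The algebra and its norms\<close>

lemma mem_A0_iff:
  "f \<in> A0 p \<longleftrightarrow>
     f holomorphic_on UNIV \<and> (\<forall>\<epsilon>>0. \<exists>K. \<forall>z. norm (f z) \<le> K * exp (\<epsilon> * p z))"
  by (simp add: A0_def bdd_above_def exp_minus divide_simps flip: divide_inverse)

lemma A0_holomorphic: "f \<in> A0 p \<Longrightarrow> f holomorphic_on UNIV"
  by (simp add: mem_A0_iff)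

lemma A0_bound:
  assumes "f \<in> A0 p" "\<epsilon> > 0"
  obtains K where "K > 0" "\<And>z. norm (f z) \<le> K * exp (\<epsilon> * p z)"
proof -
  obtain K where K: "\<And>z. norm (f z) \<le> K * exp (\<epsilon> * p z)"
    using assms mem_A0_iff by metis
  have "norm (f z) \<le> (\<bar>K\<bar> + 1) * exp (\<epsilon> * p z)" for z
  proof -
    have "K * exp (\<epsilon> * p z) \<le> (\<bar>K\<bar> + 1) * exp (\<epsilon> * p z)"
      by (intro mult_right_mono) auto
    with K[of z] show ?thesis by linarith
  qed
  then show ?thesis by (intro that[of "\<bar>K\<bar> + 1"]) auto
qed

lemma A0_const:
  assumes "growth_condition p"
  shows "(\<lambda>z. c) \<in> A0 p"
  unfolding mem_A0_iff
proof (intro conjI allI impI)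
  fix \<epsilon> :: real assume "\<epsilon> > 0"
  then have "norm c * 1 \<le> norm c * exp (\<epsilon> * p z)" for z
    using growth_condition_nonneg[OF assms, of z] by (intro mult_left_mono) auto
  then show "\<exists>K. \<forall>z. norm c \<le> K * exp (\<epsilon> * p z)" by auto
qed auto

lemma A0_add:
  assumes "f \<in> A0 p" "h \<in> A0 p"
  shows "(\<lambda>z. f z + h z) \<in> A0 p"
  unfolding mem_A0_iff
proof (intro conjI allI impI)
  show "(\<lambda>z. f z + h z) holomorphic_on UNIV"
    using assms by (intro holomorphic_intros A0_holomorphic)
  fix \<epsilon> :: real assume e: "\<epsilon> > 0"
  obtain K L where "\<And>z. norm (f z) \<le> K * exp (\<epsilon> * p z)" "\<And>z. norm (h z) \<le> L * exp (\<epsilon> * p z)"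
    using assms e mem_A0_iff by metis
  then have "norm (f z + h z) \<le> (K + L) * exp (\<epsilon> * p z)" for z
    by (simp add: distrib_right norm_triangle_mono)
  then show "\<exists>K. \<forall>z. norm (f z + h z) \<le> K * exp (\<epsilon> * p z)" by blast
qed

lemma A0_mult:
  assumes "f \<in> A0 p" "h \<in> A0 p"
  shows "(\<lambda>z. f z * h z) \<in> A0 p"
  unfolding mem_A0_iff
proof (intro conjI allI impI)
  show "(\<lambda>z. f z * h z) holomorphic_on UNIV"
    using assms by (intro holomorphic_intros A0_holomorphic)
  fix \<epsilon> :: real assume e: "\<epsilon> > 0"
  then have e2: "\<epsilon> / 2 > 0" by simp
  obtain K where K: "K > 0" "\<And>z. norm (f z) \<le> K * exp (\<epsilon> / 2 * p z)"
    using A0_bound[OF assms(1) e2] by metis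
  obtain L where L: "L > 0" "\<And>z. norm (h z) \<le> L * exp (\<epsilon> / 2 * p z)"
    using A0_bound[OF assms(2) e2] by metis
  have "norm (f z * h z) \<le> (K * L) * exp (\<epsilon> * p z)" for z
  proof -
    have "norm (f z * h z) \<le> (K * exp (\<epsilon> / 2 * p z)) * (L * exp (\<epsilon> / 2 * p z))"
      unfolding norm_mult using K L by (intro mult_mono) auto
    also have "\<dots> = (K * L) * exp (\<epsilon> / 2 * p z + \<epsilon> / 2 * p z)"
      by (simp only: exp_add mult_ac)
    also have "\<epsilon> / 2 * p z + \<epsilon> / 2 * p z = \<epsilon> * p z" by simp
    finally show ?thesis .
  qed
  then show "\<exists>K. \<forall>z. norm (f z * h z) \<le> K * exp (\<epsilon> * p z)" by blast
qed

lemma A0_cmult: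
  assumes "growth_condition p" "f \<in> A0 p"
  shows "(\<lambda>z. c * f z) \<in> A0 p"
  using A0_mult[OF A0_const[OF assms(1)] assms(2)] .

lemma A0_diff:
  assumes "growth_condition p" "f \<in> A0 p" "h \<in> A0 p"
  shows "(\<lambda>z. f z - h z) \<in> A0 p"
  using A0_add[OF assms(2) A0_cmult[OF assms(1,3), of "-1"]] by simp

lemma A0_norm_bound:
  assumes "f \<in> A0 p" "\<epsilon> > 0"
  shows "norm (f z) \<le> A0_norm p \<epsilon> f * exp (\<epsilon> * p z)"
proof -
  have "norm (f z) * exp (- \<epsilon> * p z) \<le> A0_norm p \<epsilon> f"
    unfolding A0_norm_def using assms by (intro cSUP_upper) (auto simp: A0_def)
  then show ?thesis
    by (simp add: exp_minus field_simps)
qed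

lemma A0_norm_nonneg:
  assumes "f \<in> A0 p" "\<epsilon> > 0"
  shows "0 \<le> A0_norm p \<epsilon> f"
proof -
  have "0 \<le> A0_norm p \<epsilon> f * exp (\<epsilon> * p 0)"
    using A0_norm_bound[OF assms, of 0] norm_ge_zero order_trans by blast
  then show ?thesis by (simp add: zero_le_mult_iff)
qed

lemma A0_norm_le:
  assumes "\<And>z. norm (f z) \<le> K * exp (\<epsilon> * p z)"
  shows "A0_norm p \<epsilon> f \<le> K"
  unfolding A0_norm_def
proof (rule cSUP_least)
  fix z
  show "norm (f z) * exp (- \<epsilon> * p z) \<le> K"
    using assms[of z] by (simp add: exp_minus field_simps)
qed simp

lemma A0_norm_add_le:
  assumes "f \<in> A0 p" "h \<in> A0 p" "\<epsilon> > 0"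
  shows "A0_norm p \<epsilon> (\<lambda>z. f z + h z) \<le> A0_norm p \<epsilon> f + A0_norm p \<epsilon> h"
proof (rule A0_norm_le)
  fix z
  show "norm (f z + h z) \<le> (A0_norm p \<epsilon> f + A0_norm p \<epsilon> h) * exp (\<epsilon> * p z)"
    using A0_norm_bound[OF assms(1,3), of z] A0_norm_bound[OF assms(2,3), of z]
    by (simp add: distrib_right norm_triangle_mono)
qed

text \<open>The usual boundedness criterion for linear maps. Linearity enters only through differences,
  which reduce continuity at \<open>k\<close> to continuity at the origin.\<close>

lemma continuous_map_A0_topology:
  assumes p: "growth_condition p"
    and maps: "\<And>h. h \<in> A0 p \<Longrightarrow> R h \<in> A0 p"
    and diff: "\<And>h k z. h \<in> A0 p \<Longrightarrow> k \<in> A0 p \<Longrightarrow> R h z - R k z = R (\<lambda>z. h z - k z) z"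
    and est: "\<And>\<epsilon>. \<epsilon> > 0 \<Longrightarrow> \<exists>\<delta>>0. \<exists>C. \<forall>h\<in>A0 p. A0_norm p \<epsilon> (R h) \<le> C * A0_norm p \<delta> h"
  shows "continuous_map (A0_topology p) (A0_topology p) R"
  unfolding A0_topology_def[of p, THEN arg_cong[where f = "\<lambda>Y. continuous_map (A0_topology p) Y R"]]
proof (rule continuous_on_generated_topo)
  have ts: "\<Union> {{h \<in> A0 p. A0_norm p \<epsilon> (\<lambda>z. h z - f z) < \<delta>} |f \<epsilon> \<delta>. f \<in> A0 p \<and> \<epsilon> > 0 \<and> \<delta> > 0} = A0 p"
    using topspace_A0_topology[of p]
    unfolding A0_topology_def topology_generated_by_topspace .
  show "R ` topspace (A0_topology p) \<subseteq>
      \<Union> {{h \<in> A0 p. A0_norm p \<epsilon> (\<lambda>z. h z - f z) < \<delta>} |f \<epsilon> \<delta>. f \<in> A0 p \<and> \<epsilon> > 0 \<and> \<delta> > 0}"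
    unfolding ts topspace_A0_topology using maps by blast
  fix U assume "U \<in> {{h \<in> A0 p. A0_norm p \<epsilon> (\<lambda>z. h z - f z) < \<delta>} |f \<epsilon> \<delta>. f \<in> A0 p \<and> \<epsilon> > 0 \<and> \<delta> > 0}"
  then obtain f \<epsilon> \<eta> where f: "f \<in> A0 p" "\<epsilon> > 0" "\<eta> > 0"
    and U: "U = {h \<in> A0 p. A0_norm p \<epsilon> (\<lambda>z. h z - f z) < \<eta>}"
    by blast
  obtain \<delta> C where \<delta>: "\<delta> > 0" and C: "\<And>h. h \<in> A0 p \<Longrightarrow> A0_norm p \<epsilon> (R h) \<le> C * A0_norm p \<delta> h"
    using est[OF f(2)] by blast
  show "openin (A0_topology p) (R -` U \<inter> topspace (A0_topology p))"
  proof (subst openin_subopen, intro ballI)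
    fix k assume "k \<in> R -` U \<inter> topspace (A0_topology p)"
    then have k: "k \<in> A0 p" "A0_norm p \<epsilon> (\<lambda>z. R k z - f z) < \<eta>"
      by (auto simp: U topspace_A0_topology)
    \<comment> \<open>the slack left in the target ball, divided by the bound on \<open>R\<close>; the \<open>+ 1\<close> avoids
      division by zero\<close>
    define \<tau> where "\<tau> = (\<eta> - A0_norm p \<epsilon> (\<lambda>z. R k z - f z)) / (\<bar>C\<bar> + 1)"
    have \<tau>: "\<tau> > 0" using k by (simp add: \<tau>_def)
    define T where "T = {h \<in> A0 p. A0_norm p \<delta> (\<lambda>z. h z - k z) < \<tau>}"
    have "openin (A0_topology p) T"
      unfolding A0_topology_def T_def using k(1) \<delta> \<tau>
      by (intro topology_generated_by_Basis) blast
    moreover have "k \<in> T"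
      using k \<tau> by (simp add: T_def A0_norm_def)
    moreover have "T \<subseteq> R -` U \<inter> topspace (A0_topology p)"
    proof
      fix h assume "h \<in> T"
      then have h: "h \<in> A0 p" "A0_norm p \<delta> (\<lambda>z. h z - k z) < \<tau>"
        by (auto simp: T_def)
      have hk: "(\<lambda>z. h z - k z) \<in> A0 p"
        using p h(1) k(1) by (rule A0_diff)
      have "A0_norm p \<epsilon> (\<lambda>z. R h z - f z)
          = A0_norm p \<epsilon> (\<lambda>z. R (\<lambda>z. h z - k z) z + (R k z - f z))"
        using diff[OF h(1) k(1), symmetric] by simp
      also have "\<dots> \<le> A0_norm p \<epsilon> (R (\<lambda>z. h z - k z)) + A0_norm p \<epsilon> (\<lambda>z. R k z - f z)"
        using f by (intro A0_norm_add_le maps hk A0_diff[OF p] k(1))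
      also have "A0_norm p \<epsilon> (R (\<lambda>z. h z - k z)) \<le> (\<bar>C\<bar> + 1) * A0_norm p \<delta> (\<lambda>z. h z - k z)"
        by (rule order_trans[OF C[OF hk]])
           (intro mult_right_mono A0_norm_nonneg[OF hk \<delta>], simp)
      also have "(\<bar>C\<bar> + 1) * A0_norm p \<delta> (\<lambda>z. h z - k z) < (\<bar>C\<bar> + 1) * \<tau>"
        using h(2) by (intro mult_strict_left_mono) auto
      also have "(\<bar>C\<bar> + 1) * \<tau> + A0_norm p \<epsilon> (\<lambda>z. R k z - f z) = \<eta>"
        by (simp add: \<tau>_def)
      finally have "A0_norm p \<epsilon> (\<lambda>z. R h z - f z) < \<eta>" by simp
      then show "h \<in> R -` U \<inter> topspace (A0_topology p)"
        using h maps by (simp add: U topspace_A0_topology)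
    qed
    ultimately show "\<exists>T. openin (A0_topology p) T \<and> k \<in> T \<and>
        T \<subseteq> R -` U \<inter> topspace (A0_topology p)"
      by blast
  qed
qed

section \<open>The Volterra integral\<close>

lemma entire_has_deriv: "f holomorphic_on UNIV \<Longrightarrow> (f has_field_derivative deriv f z) (at z)"
  by (simp add: holomorphic_derivI)

lemma volterra_has_field_derivative:
  assumes "g holomorphic_on UNIV" "f holomorphic_on UNIV"
  shows "(volterra g f has_field_derivative f z * deriv g z) (at z)"
proof -
  have hol: "(\<lambda>z. f z * deriv g z) holomorphic_on UNIV"
    using assms by (intro holomorphic_intros) auto
  obtain G where G: "\<And>z. (G has_field_derivative f z * deriv g z) (at z)"
    using holomorphic_convex_primitive'[OF convex_UNIV open_UNIV hol] by auto
  have "volterra g f = (\<lambda>z. G z - G 0)"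
  proof
    fix z
    have "((\<lambda>z. f z * deriv g z) has_contour_integral G (pathfinish (linepath 0 z)) - G (pathstart (linepath 0 z))) (linepath 0 z)"
      by (rule contour_integral_primitive[OF _ valid_path_linepath subset_UNIV]) (use G in simp)
    then show "volterra g f z = G z - G 0"
      unfolding volterra_def by (simp add: contour_integral_unique)
  qed
  then show ?thesis
    using G[of z] by (auto intro!: derivative_eq_intros)
qed

lemma volterra_holomorphic:
  assumes "g holomorphic_on UNIV" "f holomorphic_on UNIV"
  shows "volterra g f holomorphic_on UNIV"
  using volterra_has_field_derivative[OF assms] by (auto simp: holomorphic_on_open)

lemma volterra_0 [simp]: "volterra g f 0 = 0"
  by (simp add: volterra_def)

lemma contour_integrable_entire:
  "f holomorphic_on UNIV \<Longrightarrow> f contour_integrable_on (linepath a b)"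
  by (meson contour_integrable_holomorphic_simple open_UNIV subset_UNIV valid_path_linepath)

lemma volterra_bound:
  assumes p: "growth_condition p"
    and hol: "g holomorphic_on UNIV" "f holomorphic_on UNIV"
    and f: "\<And>w. norm (f w) \<le> F * exp (a * p w)"
    and g: "\<And>w. norm (deriv g w) \<le> G * exp (b * p w)"
    and nn: "a \<ge> 0" "b \<ge> 0" "F \<ge> 0" "G \<ge> 0"
  shows "norm (volterra g f z) \<le> norm z * (F * G * exp ((a + b) * p z))"
proof -
  have "norm (volterra g f z) \<le> (F * G * exp ((a + b) * p z)) * norm (z - 0)"
    unfolding volterra_def
  proof (rule contour_integral_bound_linepath)
    show "(\<lambda>w. f w * deriv g w) contour_integrable_on linepath 0 z"
      using hol by (intro contour_integrable_entire holomorphic_intros) auto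
    show "0 \<le> F * G * exp ((a + b) * p z)" using nn by simp
    fix w assume "w \<in> closed_segment 0 z"
    then have "norm w \<le> norm z"
      using segment_bound1 by fastforce
    then have pw: "p w \<le> p z"
      by (rule growth_condition_mono[OF p])
    have "norm (f w * deriv g w) \<le> (F * exp (a * p w)) * (G * exp (b * p w))"
      unfolding norm_mult using f g nn by (intro mult_mono) auto
    also have "\<dots> = F * G * exp ((a + b) * p w)"
      by (simp add: exp_add algebra_simps)
    also have "\<dots> \<le> F * G * exp ((a + b) * p z)"
      using pw nn by (intro mult_left_mono) (auto intro: mult_left_mono)
    finally show "norm (f w * deriv g w) \<le> F * G * exp ((a + b) * p z)" .
  qed
  then show ?thesis by (simp add: mult.commute)
qed

lemma deriv_bound:
  assumes hol: "h holomorphic_on UNIV"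
    and D: "\<And>u w. norm (u - w) \<le> 1 \<Longrightarrow> p u \<le> D * p w + D"
    and h: "\<And>w. norm (h w) \<le> B * exp (\<delta> * p w)"
    and nn: "\<delta> \<ge> 0" "B \<ge> 0"
  shows "norm (deriv h w) \<le> (B * exp (\<delta> * D)) * exp (\<delta> * D * p w)"
proof -
  have "norm ((deriv ^^ 1) h w) \<le> fact 1 * (B * exp (\<delta> * D) * exp (\<delta> * D * p w)) / 1 ^ 1"
  proof (rule Cauchy_inequality)
    show "h holomorphic_on ball w 1" using hol holomorphic_on_subset by blast
    show "continuous_on (cball w 1) h"
      using hol holomorphic_on_imp_continuous_on holomorphic_on_subset by blast
    fix u assume u: "norm (w - u) = 1"
    have "\<delta> * p u \<le> \<delta> * (D * p w + D)"
      using D[of u w] u nn by (intro mult_left_mono) (auto simp: norm_minus_commute)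
    then have "B * exp (\<delta> * p u) \<le> B * exp (\<delta> * D + \<delta> * D * p w)"
      using nn by (intro mult_left_mono) (auto simp: algebra_simps)
    with h[of u] show "norm (h u) \<le> B * exp (\<delta> * D) * exp (\<delta> * D * p w)"
      by (simp add: exp_add mult.assoc)
  qed simp
  then show ?thesis by simp
qed

text \<open>The constant \<open>C\<close> does not depend on \<open>h\<close>: this is what turns the algebraic inverse below
  into a continuous one. The factor \<open>exp (\<epsilon> * p z)\<close> is spent in three equal parts, on \<open>f\<close>, on
  \<open>h'\<close>, and on the length \<open>|z|\<close> of the path of integration.\<close>

lemma volterra_uniform_estimate:
  assumes p: "growth_condition p" and f: "f \<in> A0 p" and \<epsilon>: "\<epsilon> > 0"
  obtains \<delta> C where "\<delta> > 0" "C \<ge> 0"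
    "\<And>h z. h \<in> A0 p \<Longrightarrow> norm (volterra h f z) \<le> C * A0_norm p \<delta> h * exp (\<epsilon> * p z)"
proof -
  obtain D where D: "D \<ge> 1" "\<And>u w. norm (u - w) \<le> 1 \<Longrightarrow> p u \<le> D * p w + D"
    using growth_condition_unit_shift[OF p] by blast
  have e3: "\<epsilon> / 3 > 0" using \<epsilon> by simp
  obtain F where F: "F > 0" "\<And>z. norm (f z) \<le> F * exp (\<epsilon> / 3 * p z)"
    using A0_bound[OF f e3] by blast
  obtain K where K: "K > 0" "\<And>z::complex. 1 + norm z \<le> K * exp (\<epsilon> / 3 * p z)"
    using growth_condition_absorbs_norm[OF p e3] by blast
  define \<delta> where "\<delta> = \<epsilon> / 3 / D"
  have \<delta>: "\<delta> > 0" "\<delta> * D = \<epsilon> / 3" using e3 D by (auto simp: \<delta>_def)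
  show ?thesis
  proof (rule that[of \<delta> "K * F * exp (\<epsilon> / 3)"])
    show "\<delta> > 0" by fact
    show "0 \<le> K * F * exp (\<epsilon> / 3)" using K F by simp
    fix h z assume h: "h \<in> A0 p"
    have N: "0 \<le> A0_norm p \<delta> h" using h \<delta>(1) by (rule A0_norm_nonneg)
    have "norm (deriv h w) \<le> (A0_norm p \<delta> h * exp (\<delta> * D)) * exp (\<delta> * D * p w)" for w
      using A0_holomorphic[OF h] D(2) A0_norm_bound[OF h \<delta>(1)] less_imp_le[OF \<delta>(1)] N
      by (rule deriv_bound)
    then have "norm (deriv h w) \<le> (A0_norm p \<delta> h * exp (\<epsilon> / 3)) * exp (\<epsilon> / 3 * p w)" for w
      by (simp only: \<delta>(2))
    then have "norm (volterra h f z)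
        \<le> norm z * (F * (A0_norm p \<delta> h * exp (\<epsilon> / 3)) * exp ((\<epsilon> / 3 + \<epsilon> / 3) * p z))"
      using F e3 N by (intro volterra_bound[OF p A0_holomorphic[OF h] A0_holomorphic[OF f]]) auto
    also have "\<dots> \<le> (K * exp (\<epsilon> / 3 * p z)) *
        (F * (A0_norm p \<delta> h * exp (\<epsilon> / 3)) * exp ((\<epsilon> / 3 + \<epsilon> / 3) * p z))"
      using K(2)[of z] F N by (intro mult_right_mono) auto
    also have "\<dots> = K * F * exp (\<epsilon> / 3) * A0_norm p \<delta> h *
        exp (\<epsilon> / 3 * p z + (\<epsilon> / 3 + \<epsilon> / 3) * p z)"
      by (simp only: exp_add mult_ac)
    also have "\<epsilon> / 3 * p z + (\<epsilon> / 3 + \<epsilon> / 3) * p z = \<epsilon> * p z"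
      by (simp add: algebra_simps)
    finally show "norm (volterra h f z)
        \<le> K * F * exp (\<epsilon> / 3) * A0_norm p \<delta> h * exp (\<epsilon> * p z)" .
  qed
qed

lemma volterra_mem_A0:
  assumes "growth_condition p" "g \<in> A0 p" "f \<in> A0 p"
  shows "volterra g f \<in> A0 p"
  unfolding mem_A0_iff
proof (intro conjI allI impI)
  show "volterra g f holomorphic_on UNIV"
    using assms by (intro volterra_holomorphic A0_holomorphic)
  fix \<epsilon> :: real assume "\<epsilon> > 0"
  from volterra_uniform_estimate[OF assms(1,3) this] assms(2)
  show "\<exists>K. \<forall>z. norm (volterra g f z) \<le> K * exp (\<epsilon> * p z)"
    by metis
qed

lemma volterra_diff_left:
  assumes "h holomorphic_on UNIV" "k holomorphic_on UNIV" "f holomorphic_on UNIV"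
  shows "volterra (\<lambda>z. h z - k z) f z = volterra h f z - volterra k f z"
proof -
  have "deriv (\<lambda>z. h z - k z) w = deriv h w - deriv k w" for w
    using assms by (intro deriv_diff) (auto simp: holomorphic_on_imp_differentiable_at)
  then show ?thesis
    unfolding volterra_def using assms
    by (simp add: right_diff_distrib)
       (intro contour_integral_diff contour_integrable_entire holomorphic_intros, auto)
qed

section \<open>The resolvent\<close>

text \<open>For \<open>l \<noteq> 0\<close>, differentiating \<open>V\<^sub>g f - l f = h\<close> turns it into the linear equation
  \<open>f' - (g' / l) f = - h' / l\<close> with initial value \<open>f 0 = - h 0 / l\<close>. The definition is its solution
  by the integrating factor \<open>exp (- g / l)\<close>; the integral of \<open>h' exp (- g / l)\<close> that appears there
  is itself a Volterra integral, with \<open>h\<close> as the symbol.\<close>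

definition volterra_resolvent ::
    "(complex \<Rightarrow> complex) \<Rightarrow> complex \<Rightarrow> (complex \<Rightarrow> complex) \<Rightarrow> complex \<Rightarrow> complex" where
  "volterra_resolvent g l h z =
     - 1 / l * exp (g z / l) * (h 0 * exp (- g 0 / l) + volterra h (\<lambda>w. exp (- g w / l)) z)"

text \<open>The product \<open>f exp (- g / l)\<close> has derivative \<open>- (h' / l) exp (- g / l)\<close>, so
  \<open>l f exp (- g / l) + V\<^sub>h (exp (- g / l))\<close> is constant.\<close>

lemma volterra_resolvent_unique:
  assumes g: "g holomorphic_on UNIV" and f: "f holomorphic_on UNIV" and l: "l \<noteq> 0"
    and eq: "\<And>z. volterra g f z - l * f z = h z"
  shows "f = volterra_resolvent g l h"
proof -
  have h: "h holomorphic_on UNIV"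
  proof -
    have "(\<lambda>z. volterra g f z - l * f z) holomorphic_on UNIV"
      by (intro holomorphic_intros volterra_holomorphic g f)
    then show ?thesis by (simp add: eq)
  qed
  have dh: "deriv h z = f z * deriv g z - l * deriv f z" for z
  proof (rule DERIV_imp_deriv)
    have "((\<lambda>z. volterra g f z - l * f z) has_field_derivative f z * deriv g z - l * deriv f z) (at z)"
      by (intro derivative_intros volterra_has_field_derivative entire_has_deriv g f)
         (auto intro!: derivative_eq_intros entire_has_deriv f)
    then show "(h has_field_derivative f z * deriv g z - l * deriv f z) (at z)"
      by (simp add: eq)
  qed
  define E where "E = (\<lambda>w. exp (- g w / l))"
  have E: "E holomorphic_on UNIV" unfolding E_def using g l by (intro holomorphic_intros) auto
  have dE: "(E has_field_derivative - deriv g z / l * E z) (at z)" for z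
    unfolding E_def using l by (auto intro!: derivative_eq_intros entire_has_deriv g)
  define Q where "Q = (\<lambda>z. l * (f z * E z) + volterra h E z)"
  have "(Q has_field_derivative 0) (at z)" for z
    unfolding Q_def using l
    by (auto intro!: derivative_eq_intros entire_has_deriv f dE volterra_has_field_derivative[OF h E]
        simp: dh field_simps)
  then obtain c where c: "\<And>z. Q z = c"
    using has_field_derivative_zero_constant[of UNIV Q] by auto
  have "Q z = Q 0" for z by (simp add: c)
  then have Q: "l * (f z * E z) + volterra h E z = l * f 0 * E 0" for z
    by (simp add: Q_def)
  have h0: "h 0 = - l * f 0" using eq[of 0] by simp
  show ?thesis
  proof
    fix z
    have inv: "exp (g z / l) * E z = 1"
      by (simp add: E_def flip: exp_add)
    have "volterra_resolvent g l h z = - 1 / l * exp (g z / l) * (h 0 * E 0 + volterra h E z)"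
      by (simp add: volterra_resolvent_def E_def)
    also have "h 0 * E 0 + volterra h E z = - l * (f z * E z)"
      using Q[of z] by (simp add: h0 algebra_simps)
    also have "- 1 / l * exp (g z / l) * (- l * (f z * E z)) = f z * (exp (g z / l) * E z)"
      using l by simp
    finally show "f z = volterra_resolvent g l h z" by (simp add: inv)
  qed
qed

lemma volterra_resolvent_solves:
  assumes g: "g holomorphic_on UNIV" and h: "h holomorphic_on UNIV" and l: "l \<noteq> 0"
  shows "volterra_resolvent g l h holomorphic_on UNIV"
    and "volterra g (volterra_resolvent g l h) z - l * volterra_resolvent g l h z = h z"
proof -
  define E where "E = (\<lambda>w. exp (- g w / l))"
  have E: "E holomorphic_on UNIV" unfolding E_def using g l by (intro holomorphic_intros) auto
  define f where "f = (\<lambda>z. - 1 / l * exp (g z / l) * (h 0 * exp (- g 0 / l) + volterra h E z))"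
  have fR: "volterra_resolvent g l h = f"
    by (simp add: fun_eq_iff volterra_resolvent_def f_def E_def)
  have df: "(f has_field_derivative (f z * deriv g z - deriv h z) / l) (at z)" for z
  proof -
    have "(f has_field_derivative f z * deriv g z / l + - 1 / l * exp (g z / l) * (E z * deriv h z)) (at z)"
      unfolding f_def using l
      by (auto intro!: derivative_eq_intros entire_has_deriv g volterra_has_field_derivative[OF h E])
         (simp add: field_simps)
    moreover have "exp (g z / l) * (E z * deriv h z) = deriv h z"
      by (simp add: E_def mult.assoc[symmetric] flip: exp_add)
    ultimately show ?thesis
      by (simp add: diff_divide_distrib mult.assoc)
  qed
  show R: "volterra_resolvent g l h holomorphic_on UNIV"
    unfolding fR using df by (auto simp: holomorphic_on_open)
  then have f: "f holomorphic_on UNIV" by (simp add: fR)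
  define Q where "Q = (\<lambda>z. volterra g f z - l * f z - h z)"
  have "(Q has_field_derivative 0) (at z)" for z
    unfolding Q_def using l
    by (auto intro!: derivative_eq_intros entire_has_deriv h df volterra_has_field_derivative[OF g f]
        simp: field_simps)
  then obtain c where c: "\<And>z. Q z = c"
    using has_field_derivative_zero_constant[of UNIV Q] by auto
  have "f 0 = - h 0 / l"
    by (simp add: f_def exp_minus)
  then have "Q 0 = 0" using l by (simp add: Q_def)
  then have "Q z = 0" using c by metis
  then show "volterra g (volterra_resolvent g l h) z - l * volterra_resolvent g l h z = h z"
    by (simp add: fR Q_def)
qed

text \<open>The formula for the inverse multiplies by \<open>exp (g / l)\<close> and integrates against
  \<open>exp (- g / l)\<close>, so it acts continuously on the algebra once both exponentials belong to it.\<close>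

lemma exp_mem_A0_imp_in_resolvent_set:
  assumes p: "growth_condition p" and g: "g \<in> A0 p" and l: "l \<noteq> 0"
    and u: "(\<lambda>z. exp (g z / l)) \<in> A0 p" and v: "(\<lambda>z. exp (- g z / l)) \<in> A0 p"
  shows "l \<in> resolvent_set (A0_topology p) (volterra g)"
proof -
  define T where "T = (\<lambda>f z. volterra g f z - l * f z)"
  define R where "R = volterra_resolvent g l"
  define v where "v = (\<lambda>z. exp (- g z / l))"
  have vA: "v \<in> A0 p" using assms by (simp add: v_def)
  have R_eq: "R h z = - 1 / l * (exp (g z / l) * (h 0 * v 0 + volterra h v z))" for h z
    by (simp add: R_def volterra_resolvent_def v_def)
  have T_maps: "T f \<in> A0 p" if "f \<in> A0 p" for f
    unfolding T_def using that by (intro A0_diff A0_cmult volterra_mem_A0 p g)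
  have R_maps: "R h \<in> A0 p" if "h \<in> A0 p" for h
    unfolding R_eq[abs_def]
    using that by (intro A0_cmult[OF p] A0_mult u A0_add A0_const[OF p] volterra_mem_A0[OF p] vA)
  have TR: "T (R h) = h" if "h \<in> A0 p" for h
    using volterra_resolvent_solves(2)[OF A0_holomorphic[OF g] A0_holomorphic[OF that] l]
    by (simp add: T_def R_def fun_eq_iff)
  have RT: "R (T f) = f" if "f \<in> A0 p" for f
    using volterra_resolvent_unique[OF A0_holomorphic[OF g] A0_holomorphic[OF that] l, of "T f"]
    by (simp add: T_def R_def)
  have bij: "bij_betw T (A0 p) (A0 p)"
    by (rule bij_betw_byWitness[where f' = R]) (use T_maps R_maps TR RT in auto)
  have inv: "inv_into (A0 p) T h = R h" if "h \<in> A0 p" for h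
    using that bij R_maps TR by (metis bij_betw_def inv_into_f_f)
  have "continuous_map (A0_topology p) (A0_topology p) R"
  proof (rule continuous_map_A0_topology[OF p R_maps])
    fix h k z assume hk: "h \<in> A0 p" "k \<in> A0 p"
    show "R h z - R k z = R (\<lambda>z. h z - k z) z"
      unfolding R_eq volterra_diff_left[OF A0_holomorphic[OF hk(1)] A0_holomorphic[OF hk(2)] A0_holomorphic[OF vA]]
      by (simp add: algebra_simps diff_divide_distrib add_divide_distrib)
  next
    fix \<epsilon> :: real assume "\<epsilon> > 0"
    then have e2: "\<epsilon> / 2 > 0" by simp
    obtain \<delta> C where \<delta>: "\<delta> > 0" "C \<ge> 0" and
      C: "\<And>h z. h \<in> A0 p \<Longrightarrow> norm (volterra h v z) \<le> C * A0_norm p \<delta> h * exp (\<epsilon> / 2 * p z)"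
      using volterra_uniform_estimate[OF p vA e2] by blast
    obtain K where K: "K > 0" "\<And>z. norm (exp (g z / l)) \<le> K * exp (\<epsilon> / 2 * p z)"
      using A0_bound[OF u e2] by blast
    define L where "L = K / norm l * (exp (\<delta> * p 0) * norm (v 0) + C)"
    have "A0_norm p \<epsilon> (R h) \<le> L * A0_norm p \<delta> h" if h: "h \<in> A0 p" for h
    proof (rule A0_norm_le)
      fix z
      have N: "0 \<le> A0_norm p \<delta> h" using h \<delta>(1) by (rule A0_norm_nonneg)
      have "norm (h 0 * v 0) \<le> A0_norm p \<delta> h * exp (\<delta> * p 0) * norm (v 0) * 1"
        using A0_norm_bound[OF h \<delta>(1), of 0] by (simp add: norm_mult mult_right_mono)
      also have "\<dots> \<le> A0_norm p \<delta> h * exp (\<delta> * p 0) * norm (v 0) * exp (\<epsilon> / 2 * p z)"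
        using e2 growth_condition_nonneg[OF p, of z] N by (intro mult_left_mono) auto
      finally have 1: "norm (h 0 * v 0) \<le> \<dots>" .
      have "norm (h 0 * v 0 + volterra h v z) \<le>
          A0_norm p \<delta> h * exp (\<delta> * p 0) * norm (v 0) * exp (\<epsilon> / 2 * p z) +
          C * A0_norm p \<delta> h * exp (\<epsilon> / 2 * p z)"
        by (intro norm_triangle_mono 1 C h)
      also have "\<dots> = A0_norm p \<delta> h * (exp (\<delta> * p 0) * norm (v 0) + C) * exp (\<epsilon> / 2 * p z)"
        by (simp add: algebra_simps)
      finally have 2: "norm (h 0 * v 0 + volterra h v z) \<le> \<dots>" .
      have "norm (R h z) = 1 / norm l * (norm (exp (g z / l)) * norm (h 0 * v 0 + volterra h v z))"
        unfolding R_eq norm_mult by (simp add: norm_divide)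
      also have "\<dots> \<le> 1 / norm l * ((K * exp (\<epsilon> / 2 * p z)) *
          (A0_norm p \<delta> h * (exp (\<delta> * p 0) * norm (v 0) + C) * exp (\<epsilon> / 2 * p z)))"
        using K 2 by (intro mult_left_mono mult_mono) auto
      also have "\<dots> = L * A0_norm p \<delta> h * exp (\<epsilon> / 2 * p z + \<epsilon> / 2 * p z)"
        unfolding exp_add by (simp add: L_def)
      also have "\<epsilon> / 2 * p z + \<epsilon> / 2 * p z = \<epsilon> * p z" by simp
      finally show "norm (R h z) \<le> L * A0_norm p \<delta> h * exp (\<epsilon> * p z)" .
    qed
    with \<delta>(1) show "\<exists>\<delta>>0. \<exists>C. \<forall>h\<in>A0 p. A0_norm p \<epsilon> (R h) \<le> C * A0_norm p \<delta> h"
      by blast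
  qed
  then have "continuous_map (A0_topology p) (A0_topology p) (inv_into (A0 p) T)"
    by (rule continuous_map_eq) (simp add: topspace_A0_topology inv)
  with bij show ?thesis
    unfolding resolvent_set_def topspace_A0_topology T_def by simp
qed

text \<open>The only entire solution of \<open>V\<^sub>g f - l f = 1\<close> is a nonzero multiple of \<open>exp (g / l)\<close>.\<close>

lemma in_resolvent_set_imp_exp_mem_A0:
  assumes p: "growth_condition p" and g: "g \<in> A0 p" and l: "l \<noteq> 0"
    and "l \<in> resolvent_set (A0_topology p) (volterra g)"
  shows "(\<lambda>z. exp (g z / l)) \<in> A0 p"
proof -
  have "bij_betw (\<lambda>f z. volterra g f z - l * f z) (A0 p) (A0 p)"
    using assms(4) by (simp add: resolvent_set_def topspace_A0_topology)
  then obtain f where f: "f \<in> A0 p" "(\<lambda>z. volterra g f z - l * f z) = (\<lambda>z. 1)"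
    using A0_const[OF p, of 1] unfolding bij_betw_def by (metis (no_types, lifting) imageE)
  have "f = volterra_resolvent g l (\<lambda>z. 1)"
    using A0_holomorphic[OF g] A0_holomorphic[OF f(1)] l fun_cong[OF f(2)]
    by (rule volterra_resolvent_unique)
  then have "f z = - 1 / l * exp (- g 0 / l) * exp (g z / l)" for z
    by (simp add: volterra_resolvent_def volterra_def)
  then have "(\<lambda>z. exp (g z / l)) = (\<lambda>z. (- l * exp (g 0 / l)) * f z)"
    using l by (simp add: fun_eq_iff exp_minus)
  with A0_cmult[OF p f(1)] show ?thesis by metis
qed

text \<open>Everything in the range of \<open>V\<^sub>g\<close> vanishes at the origin, so the constant \<open>1\<close> is not hit.\<close>

lemma zero_notin_resolvent_set:
  assumes "growth_condition p"
  shows "0 \<notin> resolvent_set (A0_topology p) (volterra g)"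
proof
  assume "0 \<in> resolvent_set (A0_topology p) (volterra g)"
  then have "bij_betw (volterra g) (A0 p) (A0 p)"
    by (simp add: resolvent_set_def topspace_A0_topology)
  then obtain f where "volterra g f = (\<lambda>z. 1)"
    using A0_const[OF assms, of 1] unfolding bij_betw_def by (metis (no_types, lifting) imageE)
  then have "volterra g f 0 = 1" by simp
  then show False by simp
qed

section \<open>The maximum modulus\<close>

text \<open>The map \<open>\<zeta> \<mapsto> \<zeta> / (2 A - \<zeta>)\<close> takes the half plane \<open>Re \<zeta> < A\<close> into the unit disc and fixes \<open>0\<close>,
  so after rescaling the disc the Schwarz lemma applies to its composition with \<open>f\<close>.\<close>

lemma Borel_Caratheodory:
  assumes hol: "f holomorphic_on ball 0 R" and f0: "f 0 = 0"
    and Re: "\<And>w. norm w < R \<Longrightarrow> Re (f w) < A" and z: "norm z < R"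
  shows "norm (f z) \<le> 2 * A * norm z / (R - norm z)"
proof -
  have R: "R > 0" using z norm_ge_zero le_less_trans by blast
  have A: "A > 0" using Re[of 0] f0 R by simp
  define F where "F = (\<lambda>u. f (of_real R * u))"
  define h where "h = (\<lambda>u. F u / (2 * of_real A - F u))"
  have F: "F holomorphic_on ball 0 1"
    unfolding F_def
    by (rule holomorphic_on_compose_gen[OF _ hol, unfolded o_def])
       (use R in \<open>auto intro!: holomorphic_intros simp: norm_mult\<close>)
  have ReF: "Re (F u) < A" if "norm u < 1" for u
    using that R unfolding F_def by (intro Re) (simp add: norm_mult)
  have nz: "2 * of_real A - F u \<noteq> 0" if "norm u < 1" for u
  proof
    assume "2 * of_real A - F u = 0"
    then have "Re (F u) = 2 * A" by (metis Re_complex_of_real eq_iff_diff_eq_0 of_real_mult of_real_numeral)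
    with ReF[OF that] A show False by simp
  qed
  have F_less: "norm (F u) < norm (2 * of_real A - F u)" if "norm u < 1" for u
  proof -
    have "(norm (F u))\<^sup>2 < (norm (2 * of_real A - F u))\<^sup>2"
      using mult_strict_left_mono[OF ReF[OF that] A]
      unfolding cmod_power2 by (simp add: power2_eq_square algebra_simps)
    then show ?thesis by (rule power2_less_imp_less) simp
  qed
  have "norm (h (z / of_real R)) \<le> norm (z / of_real R)"
  proof (rule Schwarz_Lemma)
    show "h holomorphic_on ball 0 1"
      unfolding h_def using nz F by (intro holomorphic_intros) auto
    show "h 0 = 0" by (simp add: h_def F_def f0)
    show "norm (h u) < 1" if "norm u < 1" for u
      using F_less[OF that] nz[OF that] by (simp add: h_def norm_divide)
    show "norm (z / of_real R) < 1" using z R by (simp add: norm_divide)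
  qed
  moreover have "F (z / of_real R) = f z" using R by (simp add: F_def)
  moreover have zR: "norm (z / of_real R) < 1" using z R by (simp add: norm_divide)
  ultimately have "norm (f z) / norm (2 * of_real A - f z) \<le> norm z / R"
    using R by (simp add: h_def norm_divide)
  moreover have "norm (2 * of_real A - f z) > 0"
    using nz[OF zR] \<open>F (z / of_real R) = f z\<close> by simp
  ultimately have "R * norm (f z) \<le> norm z * norm (2 * of_real A - f z)"
    using R by (simp add: field_simps)
  also have "\<dots> \<le> norm z * (2 * A + norm (f z))"
    using norm_triangle_ineq4[of "2 * of_real A" "f z"] A
    by (intro mult_left_mono) (auto simp: norm_mult)
  finally show ?thesis
    using z by (simp add: field_simps)
qed

lemma norm_le_max_modulus:
  assumes "g holomorphic_on UNIV"
  shows "norm (g z) \<le> max_modulus g (norm z)"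
proof -
  have "compact ((\<lambda>z. norm (g z)) ` sphere 0 (norm z))"
    using assms
    by (intro compact_continuous_image continuous_intros)
       (auto intro: holomorphic_on_imp_continuous_on holomorphic_on_subset)
  then show ?thesis
    unfolding max_modulus_def
    by (intro cSUP_upper) (auto simp: bounded_imp_bdd_above compact_imp_bounded)
qed

lemma max_modulus_le:
  assumes "r \<ge> 0" "\<And>z. norm z = r \<Longrightarrow> norm (g z) \<le> B"
  shows "max_modulus g r \<le> B"
  unfolding max_modulus_def using assms by (intro cSUP_least) auto

lemma max_modulus_nonneg:
  assumes "g holomorphic_on UNIV" "r \<ge> 0"
  shows "0 \<le> max_modulus g r"
  using order_trans[OF norm_ge_zero norm_le_max_modulus[OF assms(1), of "of_real r"]] assms(2)
  by simp

text \<open>The condition on the maximum modulus, as a pointwise estimate on the whole plane. An additive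
  constant is harmless because \<open>p\<close> tends to infinity.\<close>

lemma max_modulus_smallo_iff:
  assumes p: "growth_condition p" and g: "g holomorphic_on UNIV"
  shows "max_modulus g \<in> o(\<lambda>r. p (of_real r)) \<longleftrightarrow>
           (\<forall>\<epsilon>>0. \<exists>K. \<forall>z. norm (g z) \<le> \<epsilon> * p z + K)" (is "?L \<longleftrightarrow> ?R")
proof
  assume L: ?L
  show ?R
  proof (intro allI impI)
    fix \<epsilon> :: real assume e: "\<epsilon> > 0"
    from landau_o.smallD[OF L e] obtain N
      where N: "\<And>r. r \<ge> N \<Longrightarrow> \<bar>max_modulus g r\<bar> \<le> \<epsilon> * p (of_real r)"
      using growth_condition_nonneg[OF p] by (auto simp: eventually_at_top_linorder)
    have "bounded (g ` cball 0 N)"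
      using holomorphic_on_imp_continuous_on[OF g]
      by (intro compact_imp_bounded compact_continuous_image)
         (auto intro: continuous_on_subset)
    then obtain K where K: "K > 0" "\<And>z. z \<in> cball 0 N \<Longrightarrow> norm (g z) \<le> K"
      unfolding bounded_pos by blast
    have "norm (g z) \<le> \<epsilon> * p z + K" for z
    proof (cases "norm z \<ge> N")
      case True
      then show ?thesis
        using N[OF True] norm_le_max_modulus[OF g, of z] K(1)
        by (simp add: growth_condition_radial[OF p])
    next
      case False
      then have "norm (g z) \<le> K" by (intro K(2)) simp
      then show ?thesis using e growth_condition_nonneg[OF p, of z] by (simp add: add_increasing)
    qed
    then show "\<exists>K. \<forall>z. norm (g z) \<le> \<epsilon> * p z + K" by blast
  qed
next
  assume R: ?R
  show ?L
  proof (rule landau_o.smallI)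
    fix \<epsilon> :: real assume e: "\<epsilon> > 0"
    then have "\<epsilon> / 2 > 0" by simp
    then obtain K where K: "\<And>z. norm (g z) \<le> \<epsilon> / 2 * p z + K"
      using R by blast
    have "\<forall>\<^sub>F r in at_top. 2 * K / \<epsilon> \<le> p (of_real r)"
      using growth_condition_tends_to_infinity[OF p] by (simp add: filterlim_at_top)
    then show "\<forall>\<^sub>F r in at_top. norm (max_modulus g r) \<le> \<epsilon> * norm (p (of_real r))"
      using eventually_ge_at_top[of 0]
    proof eventually_elim
      case (elim r)
      have "max_modulus g r \<le> \<epsilon> / 2 * p (of_real r) + K"
      proof (rule max_modulus_le[OF elim(2)])
        fix z :: complex assume "norm z = r"
        then have "p z = p (of_real r)" by (metis growth_condition_radial[OF p])
        with K[of z] show "norm (g z) \<le> \<epsilon> / 2 * p (of_real r) + K" by simp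
      qed
      also have "\<dots> \<le> \<epsilon> * p (of_real r)"
        using elim(1) e by (simp add: field_simps)
      finally show ?case
        using max_modulus_nonneg[OF g elim(2)] growth_condition_nonneg[OF p] by simp
    qed
  qed
qed

lemma smallo_imp_exp_mem_A0:
  assumes p: "growth_condition p" and g: "g holomorphic_on UNIV"
    and o: "max_modulus g \<in> o(\<lambda>r. p (of_real r))"
  shows "(\<lambda>z. exp (g z / l)) \<in> A0 p"
proof (cases "l = 0")
  case True
  \<comment> \<open>division by zero makes the exponential the constant \<open>1\<close>\<close>
  then show ?thesis using A0_const[OF p, of 1] by simp
next
  case l: False
  show ?thesis
    unfolding mem_A0_iff
  proof (intro conjI allI impI)
    show "(\<lambda>z. exp (g z / l)) holomorphic_on UNIV"
      using g l by (intro holomorphic_intros) auto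
    fix \<epsilon> :: real assume "\<epsilon> > 0"
    then have "\<epsilon> * norm l > 0" using l by simp
    then obtain K where K: "\<And>z. norm (g z) \<le> \<epsilon> * norm l * p z + K"
      using o unfolding max_modulus_smallo_iff[OF p g] by blast
    have "norm (exp (g z / l)) \<le> exp (K / norm l) * exp (\<epsilon> * p z)" for z
    proof -
      have "Re (g z / l) \<le> norm (g z) / norm l"
        using complex_Re_le_cmod[of "g z / l"] by (simp add: norm_divide)
      also have "\<dots> \<le> (\<epsilon> * norm l * p z + K) / norm l"
        using K by (intro divide_right_mono) auto
      also have "\<dots> = K / norm l + \<epsilon> * p z" using l by (simp add: add_divide_distrib)
      finally show ?thesis by (simp flip: exp_add)
    qed
    then show "\<exists>K. \<forall>z. norm (exp (g z / l)) \<le> K * exp (\<epsilon> * p z)" by blast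
  qed
qed

text \<open>Membership of \<open>exp (g / l)\<close> in the algebra bounds only the real part of \<open>g / l\<close> from above.
  The Borel--Caratheodory inequality upgrades this to a bound on \<open>|g|\<close>, at the price of doubling
  the radius, which a growth condition tolerates.\<close>

lemma exp_mem_A0_imp_smallo:
  assumes p: "growth_condition p" and g: "g holomorphic_on UNIV"
    and l: "l \<noteq> 0" and e: "(\<lambda>z. exp (g z / l)) \<in> A0 p"
  shows "max_modulus g \<in> o(\<lambda>r. p (of_real r))"
  unfolding max_modulus_smallo_iff[OF p g]
proof (intro allI impI)
  fix \<epsilon> :: real assume \<epsilon>: "\<epsilon> > 0"
  have nn: "0 \<le> p z" for z using p by (rule growth_condition_nonneg)
  obtain D where D: "D \<ge> 1" "\<And>z. p (2 * z) \<le> D * p z + D"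
    using growth_condition_doubling[OF p] by blast
  \<comment> \<open>compensates the factors \<open>2\<close> from Borel--Caratheodory, \<open>D\<close> from doubling, and \<open>|l|\<close>\<close>
  define \<delta> where "\<delta> = \<epsilon> / (2 * D * norm l)"
  have \<delta>: "\<delta> > 0" using \<epsilon> D l by (simp add: \<delta>_def)
  obtain K where K: "K > 0" "\<And>z. norm (exp (g z / l)) \<le> K * exp (\<delta> * p z)"
    using A0_bound[OF e \<delta>] by blast
  define f where "f = (\<lambda>z. (g z - g 0) / l)"
  define B where "B = \<bar>ln K\<bar> + norm (g 0 / l) + 1"
  have Re: "Re (f w) < \<delta> * p w + B" for w
  proof -
    have "exp (Re (g w / l)) \<le> exp (ln K + \<delta> * p w)"
      using K(2)[of w] K(1) by (simp add: exp_add)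
    then have "Re (g w / l) \<le> ln K + \<delta> * p w" by simp
    moreover have "- Re (g 0 / l) \<le> norm (g 0 / l)"
      using abs_Re_le_cmod[of "g 0 / l"] by linarith
    moreover have "Re (f w) = Re (g w / l) - Re (g 0 / l)"
      by (simp add: f_def diff_divide_distrib)
    ultimately show ?thesis by (simp add: B_def)
  qed
  have "norm (f z) \<le> 2 * (\<delta> * p (2 * z) + B)" for z
  proof (cases "z = 0")
    case True
    then show ?thesis using \<delta> nn[of 0] by (simp add: f_def B_def)
  next
    case False
    have "norm (f z) \<le> 2 * (\<delta> * p (2 * z) + B) * norm z / (2 * norm z - norm z)"
    proof (rule Borel_Caratheodory)
      show "f holomorphic_on ball 0 (2 * norm z)"
        unfolding f_def using l
        by (intro holomorphic_intros holomorphic_on_subset[OF g]) auto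
      fix w :: complex assume "norm w < 2 * norm z"
      then have "p w \<le> p (2 * z)"
        by (intro growth_condition_mono[OF p]) (simp add: norm_mult)
      then have "\<delta> * p w \<le> \<delta> * p (2 * z)" using \<delta> by simp
      then show "Re (f w) < \<delta> * p (2 * z) + B" using Re[of w] by linarith
    qed (use False in \<open>auto simp: f_def\<close>)
    then show ?thesis using False by simp
  qed note f_bound = this
  have "norm (g z) \<le> \<epsilon> * p z + (\<epsilon> + 2 * B * norm l + norm (g 0))" for z
  proof -
    have "g z = l * f z + g 0" using l by (simp add: f_def)
    then have "norm (g z) \<le> norm l * norm (f z) + norm (g 0)"
      by (metis norm_mult norm_triangle_ineq)
    also have "norm l * norm (f z) \<le> norm l * (2 * (\<delta> * (D * p z + D) + B))"
    proof (intro mult_left_mono)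
      have "\<delta> * p (2 * z) \<le> \<delta> * (D * p z + D)" using D(2) \<delta> by (intro mult_left_mono) auto
      then have "2 * (\<delta> * p (2 * z) + B) \<le> 2 * (\<delta> * (D * p z + D) + B)" by simp
      with f_bound[of z] show "norm (f z) \<le> 2 * (\<delta> * (D * p z + D) + B)" by (rule order_trans)
    qed simp
    also have "norm l * (2 * (\<delta> * (D * p z + D) + B)) = (2 * D * norm l * \<delta>) * (p z + 1) + 2 * B * norm l"
      by (simp add: algebra_simps)
    also have "2 * D * norm l * \<delta> = \<epsilon>" using D l by (simp add: \<delta>_def)
    finally show ?thesis by (simp add: algebra_simps)
  qed
  then show "\<exists>K. \<forall>z. norm (g z) \<le> \<epsilon> * p z + K" by blast
qed

text \<open>A growth condition is dominated by a power of \<open>|z|\<close>, so \<open>g\<close> has polynomial growth and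
  Liouville's theorem applies.\<close>

lemma smallo_imp_polynomial:
  assumes p: "growth_condition p" and g: "g holomorphic_on UNIV"
    and o: "max_modulus g \<in> o(\<lambda>r. p (of_real r))"
  shows "\<exists>q :: complex poly. \<forall>z. g z = poly q z"
proof -
  obtain n where n: "\<And>z. p z + 1 \<le> (p 1 + 1) * (max 1 (2 * norm z)) ^ n"
    using growth_condition_polynomial_bound[OF p] by blast
  obtain K where K: "\<And>z. norm (g z) \<le> 1 * p z + K"
    using o zero_less_one unfolding max_modulus_smallo_iff[OF p g] by blast
  have "norm (g z) \<le> ((p 1 + 1) * 2 ^ n + \<bar>K\<bar>) * norm z ^ n" if z: "1 \<le> norm z" for z
  proof -
    have "p z \<le> (p 1 + 1) * 2 ^ n * norm z ^ n"
      using n[of z] z by (simp add: max_def power_mult_distrib)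
    moreover have "K \<le> \<bar>K\<bar> * norm z ^ n"
      using z one_le_power[OF z, of n] mult_left_mono[of 1 "norm z ^ n" "\<bar>K\<bar>"] by simp
    ultimately show ?thesis using K[of z] by (simp add: distrib_right)
  qed
  note liouville = Liouville_polynomial[OF g this]
  have "g z = poly (\<Sum>k\<le>n. monom ((deriv ^^ k) g 0 / fact k) k) z" for z
    using liouville[where \<xi> = z] by (simp add: poly_sum poly_monom)
  then show ?thesis by blast
qed

text \<open>Some derivative \<open>(deriv ^^ k) g 0\<close> with \<open>k > 0\<close> is nonzero, and the Cauchy estimate on \<open>|z| = r\<close> makes
  \<open>r ^ k\<close>, hence also \<open>r\<close> once \<open>r \<ge> 1\<close>, at most a constant multiple of the maximum modulus.\<close>

lemma ident_bigo_max_modulus: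
  assumes g: "g holomorphic_on UNIV" and nc: "\<not> g constant_on UNIV"
  shows "(\<lambda>r::real. r) \<in> O(max_modulus g)"
proof -
  obtain k where k: "k > 0" "(deriv ^^ k) g 0 \<noteq> 0"
    using holomorphic_fun_eq_const_on_connected[OF g open_UNIV connected_UNIV, of 0] nc
    unfolding constant_on_def by blast
  define a where "a = norm ((deriv ^^ k) g 0)"
  have a: "a > 0" using k by (simp add: a_def)
  have "r \<le> fact k / a * max_modulus g r" if r: "r \<ge> 1" for r
  proof -
    have "a \<le> fact k * max_modulus g r / r ^ k"
      unfolding a_def
    proof (rule Cauchy_inequality)
      show "g holomorphic_on ball 0 r" using g holomorphic_on_subset by blast
      show "continuous_on (cball 0 r) g"
        using g holomorphic_on_imp_continuous_on holomorphic_on_subset by blast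
      show "norm (g z) \<le> max_modulus g r" if "norm (0 - z) = r" for z
        using norm_le_max_modulus[OF g, of z] that by simp
    qed (use r in simp)
    then have "r ^ k \<le> fact k / a * max_modulus g r"
      using a r by (simp add: field_simps)
    moreover have "r \<le> r ^ k" using r k(1) by (simp add: self_le_power)
    ultimately show ?thesis by linarith
  qed
  note ge_1 = this
  have "\<forall>\<^sub>F r in at_top. norm r \<le> fact k / a * norm (max_modulus g r)"
    using eventually_ge_at_top[of 1]
  proof eventually_elim
    case (elim r)
    then show ?case using ge_1[of r] max_modulus_nonneg[OF g, of r] by simp
  qed
  then show ?thesis by (rule bigoI)
qed

theorem theorem3p5:
  fixes p :: "complex \<Rightarrow> real" and g :: "complex \<Rightarrow> complex"
  assumes "growth_condition p"
    and "g \<in> A0 p"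
    and "\<not> g constant_on UNIV"
  shows "(max_modulus g \<notin> o(\<lambda>r. p (of_real r)) \<longrightarrow>
            spectrum (A0_topology p) (volterra g) = UNIV) \<and>
         ((\<lambda>r. p (of_real r)) \<in> O(\<lambda>r::real. r) \<longrightarrow>
            max_modulus g \<notin> o(\<lambda>r. p (of_real r))) \<and>
         (max_modulus g \<in> o(\<lambda>r. p (of_real r)) \<longrightarrow>
            spectrum (A0_topology p) (volterra g) = {0} \<and>
            (\<exists>q :: complex poly. \<forall>z. g z = poly q z) \<and>
            (\<lambda>r::real. r) \<in> o(\<lambda>r. p (of_real r))) \<and>
         spectrum (A0_topology p) (volterra g) =
            {0} \<union> closure {l. l \<noteq> 0 \<and> (\<lambda>z. exp (g z / l)) \<notin> A0 p}"
proof -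
  have g: "g holomorphic_on UNIV" using assms(2) by (rule A0_holomorphic)
  have zero: "0 \<in> spectrum (A0_topology p) (volterra g)"
    using zero_notin_resolvent_set[OF assms(1)] by (simp add: spectrum_def)
  have id_smallo: "(\<lambda>r::real. r) \<in> o(\<lambda>r. p (of_real r))"
    if "max_modulus g \<in> o(\<lambda>r. p (of_real r))"
    using ident_bigo_max_modulus[OF g assms(3)] that by (rule landau_o.big_small_trans)
  have linear: "max_modulus g \<notin> o(\<lambda>r. p (of_real r))"
    if "(\<lambda>r. p (of_real r)) \<in> O(\<lambda>r::real. r)"
  proof
    assume "max_modulus g \<in> o(\<lambda>r. p (of_real r))"
    from landau_o.small_big_trans[OF id_smallo[OF this] that]
    have "\<forall>\<^sub>F r in at_top. r = (0::real)"
      by (simp add: landau_o.small_refl_iff)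
    from eventually_conj[OF this eventually_gt_at_top[of 0]]
    have "\<forall>\<^sub>F r::real in at_top. False"
      by (rule eventually_mono) auto
    then show False by simp
  qed
  show ?thesis
  proof (cases "max_modulus g \<in> o(\<lambda>r. p (of_real r))")
    case True
    note in_A0 = smallo_imp_exp_mem_A0[OF assms(1) g True]
    have "l \<in> resolvent_set (A0_topology p) (volterra g)" if "l \<noteq> 0" for l
      using in_A0[of l] in_A0[of "- l"] that
      by (intro exp_mem_A0_imp_in_resolvent_set[OF assms(1,2)]) auto
    then have "spectrum (A0_topology p) (volterra g) = {0}"
      using zero by (auto simp: spectrum_def)
    then show ?thesis
      using True linear id_smallo[OF True] smallo_imp_polynomial[OF assms(1) g True] in_A0
      by auto
  next
    case False
    then have notin: "(\<lambda>z. exp (g z / l)) \<notin> A0 p" if "l \<noteq> 0" for l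
      using exp_mem_A0_imp_smallo[OF assms(1) g that] by blast
    then have "l \<in> spectrum (A0_topology p) (volterra g)" for l
      using zero in_resolvent_set_imp_exp_mem_A0[OF assms(1,2), of l]
      by (cases "l = 0") (auto simp: spectrum_def)
    then have "spectrum (A0_topology p) (volterra g) = UNIV" by blast
    moreover have "{l. l \<noteq> 0 \<and> (\<lambda>z. exp (g z / l)) \<notin> A0 p} = - {0}"
      using notin by auto
    moreover have "{0} \<union> closure (- {0 :: complex}) = UNIV"
      using closure_subset[of "- {0 :: complex}"] by blast
    ultimately show ?thesis using False by simp
  qed
qed

end
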